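(* For every positive integer $k$, $J^{(k)}\supseteq\mathbb Q(q)\otimes_{\mathbb Z}I_{\mathrm{Assaf}}^{(k)}$ (viewing $\mathcal U\subset\mathcal U_q$).
   Context: $\mathcal U=\mathbb Z\langle u_1,\dots,u_N\rangle$, $\mathcal U_q=\mathbb Q(q)\otimes_{\mathbb Z}\mathcal U$ with $\mathbb Q(q)$ the field of rational functions in $q$. Lam's ideal $J^{(k)}$ is the two-sided ideal of $\mathcal U_q$ generated by $u_a^2$ (all $a$), $u_{a+k}u_au_{a+k}$ (all $a$), $u_au_{a+k}u_a$ (all $a$), $u_au_b-u_bu_a$ for $b-a>k$, and $u_au_b-q^{-1}u_bu_a$ for $0<b-a<k$ (all indices in $\{1,\dots,N\}$). The Assaf ideal $I_{\mathrm{Assaf}}^{(k)}$ is the two-sided ideal of $\mathcal U$ generated by all monomials $\mathbf u_{\mathsf w}=u_{\mathsf w_1}\cdots u_{\mathsf w_n}$ lying in $J^{(k)}$, together with $u_bu_au_c-u_bu_cu_a$ and $u_au_cu_b-u_cu_au_b$ for $a<b<c$ with $c-a>k$, and $u_bu_au_c-u_au_cu_b$ and $u_bu_cu_a-u_cu_au_b$ for $a<b<c$ with $c-a\le k$. *)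

theory Defs
  imports "HOL-Library.Poly_Mapping" "HOL-Computational_Algebra.Fraction_Field"
          "HOL-Computational_Algebra.Polynomial"
begin

text \<open>Noncommutative polynomials: finitely supported coefficient functions on words
  (lists of letter indices). The word [a1,...,an] stands for u_a1 ... u_an.\<close>

type_synonym 'a ncpoly = "nat list \<Rightarrow>\<^sub>0 'a"

definition nc_mult :: "'a::comm_ring_1 ncpoly \<Rightarrow> 'a ncpoly \<Rightarrow> 'a ncpoly" (infixl "\<star>" 70) where
  "p \<star> r = (\<Sum>v\<in>Poly_Mapping.keys p. \<Sum>w\<in>Poly_Mapping.keys r. Poly_Mapping.single (v @ w) (Poly_Mapping.lookup p v * Poly_Mapping.lookup r w))"

definition mon :: "nat list \<Rightarrow> 'a::comm_ring_1 ncpoly" where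
  "mon w = Poly_Mapping.single w 1"

definition smul :: "'a::comm_ring_1 \<Rightarrow> 'a ncpoly \<Rightarrow> 'a ncpoly" where
  "smul c p = Poly_Mapping.map (\<lambda>x. c * x) p"

definition nc_alg :: "nat \<Rightarrow> 'a::comm_ring_1 ncpoly set" where
  "nc_alg N = {p. \<forall>w\<in>Poly_Mapping.keys p. set w \<subseteq> {1..N}}"

inductive_set ideal_gen :: "nat \<Rightarrow> 'a::comm_ring_1 ncpoly set \<Rightarrow> 'a ncpoly set"
  for N S where
  gen: "s \<in> S \<Longrightarrow> s \<in> ideal_gen N S"
| zero: "0 \<in> ideal_gen N S"
| add: "x \<in> ideal_gen N S \<Longrightarrow> y \<in> ideal_gen N S \<Longrightarrow> x + y \<in> ideal_gen N S"
| mult: "a \<in> nc_alg N \<Longrightarrow> b \<in> nc_alg N \<Longrightarrow> x \<in> ideal_gen N S \<Longrightarrow> a \<star> x \<star> b \<in> ideal_gen N S"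

type_synonym Qq = "rat poly fract"

definition qvar :: Qq where "qvar = Fraction_Field.Fract [:0, 1:] 1"

definition lam_gens :: "nat \<Rightarrow> nat \<Rightarrow> Qq ncpoly set" where
  "lam_gens N k =
     {mon [a, a] | a. a \<in> {1..N}}
   \<union> {mon [a + k, a, a + k] | a. a \<in> {1..N} \<and> a + k \<in> {1..N}}
   \<union> {mon [a, a + k, a] | a. a \<in> {1..N} \<and> a + k \<in> {1..N}}
   \<union> {mon [a, b] - mon [b, a] | a b. a \<in> {1..N} \<and> b \<in> {1..N} \<and> a < b \<and> b - a > k}
   \<union> {mon [a, b] - smul (inverse qvar) (mon [b, a]) | a b.
        a \<in> {1..N} \<and> b \<in> {1..N} \<and> a < b \<and> b - a < k}"

definition lam_ideal :: "nat \<Rightarrow> nat \<Rightarrow> Qq ncpoly set" where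
  "lam_ideal N k = ideal_gen N (lam_gens N k)"

definition incl :: "int ncpoly \<Rightarrow> Qq ncpoly" where
  "incl p = Poly_Mapping.map of_int p"

definition assaf_gens :: "nat \<Rightarrow> nat \<Rightarrow> int ncpoly set" where
  "assaf_gens N k =
     {mon w | w. set w \<subseteq> {1..N} \<and> incl (mon w) \<in> lam_ideal N k}
   \<union> {mon [b, a, c] - mon [b, c, a] | a b c.
        c \<in> {1..N} \<and> 1 \<le> a \<and> a < b \<and> b < c \<and> c - a > k}
   \<union> {mon [a, c, b] - mon [c, a, b] | a b c.
        c \<in> {1..N} \<and> 1 \<le> a \<and> a < b \<and> b < c \<and> c - a > k}
   \<union> {mon [b, a, c] - mon [a, c, b] | a b c.
        c \<in> {1..N} \<and> 1 \<le> a \<and> a < b \<and> b < c \<and> c - a \<le> k}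
   \<union> {mon [b, c, a] - mon [c, a, b] | a b c.
        c \<in> {1..N} \<and> 1 \<le> a \<and> a < b \<and> b < c \<and> c - a \<le> k}"

definition assaf_ideal :: "nat \<Rightarrow> nat \<Rightarrow> int ncpoly set" where
  "assaf_ideal N k = ideal_gen N (assaf_gens N k)"

text \<open>Q(q) \<otimes>_Z I, viewed inside U_q: the Q(q)-span of the image of I.\<close>
inductive_set scalar_ext :: "int ncpoly set \<Rightarrow> Qq ncpoly set" for I where
  zero: "0 \<in> scalar_ext I"
| gen: "x \<in> I \<Longrightarrow> smul c (incl x) \<in> scalar_ext I"
| add: "y \<in> scalar_ext I \<Longrightarrow> z \<in> scalar_ext I \<Longrightarrow> y + z \<in> scalar_ext I"

end

theory Submission
  imports Defs
begin

text \<open>Every generator of Assaf's ideal is, inside U_q, a combination of Lam's relations with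
  monomial and scalar coefficients. For
  c - a > k the others are u_b (u_a u_c - u_c u_a) and (u_a u_c - u_c u_a) u_b. For c - a \<le> k both
  pairs a < b and b < c q-commute, and with g(x, y) = u_x u_y - q^-1 u_y u_x
    u_b u_a u_c - u_a u_c u_b = -q g(a, b) u_c + q u_a g(b, c),
    u_b u_c u_a - u_c u_a u_b = g(b, c) u_a - u_c g(a, b).
  Since the inclusion U \<subseteq> U_q is multiplicative it maps the whole Assaf ideal into J, and J is
  closed under Q(q)-scalars.\<close>

lemma lookup_map_zero:
  "f 0 = 0 \<Longrightarrow> Poly_Mapping.lookup (Poly_Mapping.map f p) w = f (Poly_Mapping.lookup p w)"
  by (simp add: Poly_Mapping.map.rep_eq when_def)

lemma nc_mult_eq_sum_supset:
  fixes p r :: "'a::comm_ring_1 ncpoly"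
  assumes "finite A" "finite B" "Poly_Mapping.keys p \<subseteq> A" "Poly_Mapping.keys r \<subseteq> B"
  shows "p \<star> r = (\<Sum>v\<in>A. \<Sum>w\<in>B.
           Poly_Mapping.single (v @ w) (Poly_Mapping.lookup p v * Poly_Mapping.lookup r w))"
proof -
  have "p \<star> r = (\<Sum>v\<in>A. \<Sum>w\<in>Poly_Mapping.keys r.
           Poly_Mapping.single (v @ w) (Poly_Mapping.lookup p v * Poly_Mapping.lookup r w))"
    unfolding nc_mult_def
    by (rule sum.mono_neutral_left) (use assms in \<open>auto simp: in_keys_iff\<close>)
  also have "\<dots> = (\<Sum>v\<in>A. \<Sum>w\<in>B.
           Poly_Mapping.single (v @ w) (Poly_Mapping.lookup p v * Poly_Mapping.lookup r w))"
    by (rule sum.cong[OF refl], rule sum.mono_neutral_left) (use assms in \<open>auto simp: in_keys_iff\<close>)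
  finally show ?thesis .
qed

lemma nc_mult_add_left:
  fixes x y z :: "'a::comm_ring_1 ncpoly"
  shows "(x + y) \<star> z = x \<star> z + y \<star> z"
proof -
  let ?A = "Poly_Mapping.keys x \<union> Poly_Mapping.keys y \<union> Poly_Mapping.keys (x + y)"
  let ?B = "Poly_Mapping.keys z"
  have "(x + y) \<star> z = (\<Sum>v\<in>?A. \<Sum>w\<in>?B.
          Poly_Mapping.single (v @ w) (Poly_Mapping.lookup (x + y) v * Poly_Mapping.lookup z w))"
    by (rule nc_mult_eq_sum_supset) auto
  also have "\<dots> = (\<Sum>v\<in>?A. \<Sum>w\<in>?B.
          Poly_Mapping.single (v @ w) (Poly_Mapping.lookup x v * Poly_Mapping.lookup z w))
     + (\<Sum>v\<in>?A. \<Sum>w\<in>?B.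
          Poly_Mapping.single (v @ w) (Poly_Mapping.lookup y v * Poly_Mapping.lookup z w))"
    by (simp add: lookup_add distrib_right single_add sum.distrib)
  also have "\<dots> = x \<star> z + y \<star> z"
    by (subst (1 2) nc_mult_eq_sum_supset[where A = ?A and B = ?B]) auto
  finally show ?thesis .
qed

lemma nc_mult_add_right:
  fixes x y z :: "'a::comm_ring_1 ncpoly"
  shows "z \<star> (x + y) = z \<star> x + z \<star> y"
proof -
  let ?A = "Poly_Mapping.keys z"
  let ?B = "Poly_Mapping.keys x \<union> Poly_Mapping.keys y \<union> Poly_Mapping.keys (x + y)"
  have "z \<star> (x + y) = (\<Sum>v\<in>?A. \<Sum>w\<in>?B.
          Poly_Mapping.single (v @ w) (Poly_Mapping.lookup z v * Poly_Mapping.lookup (x + y) w))"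
    by (rule nc_mult_eq_sum_supset) auto
  also have "\<dots> = (\<Sum>v\<in>?A. \<Sum>w\<in>?B.
          Poly_Mapping.single (v @ w) (Poly_Mapping.lookup z v * Poly_Mapping.lookup x w))
     + (\<Sum>v\<in>?A. \<Sum>w\<in>?B.
          Poly_Mapping.single (v @ w) (Poly_Mapping.lookup z v * Poly_Mapping.lookup y w))"
    by (simp add: lookup_add distrib_left single_add sum.distrib)
  also have "\<dots> = z \<star> x + z \<star> y"
    by (subst (1 2) nc_mult_eq_sum_supset[where A = ?A and B = ?B]) auto
  finally show ?thesis .
qed

lemma nc_mult_diff_left:
  fixes x y z :: "'a::comm_ring_1 ncpoly"
  shows "(x - y) \<star> z = x \<star> z - y \<star> z"
  using nc_mult_add_left[of "x - y" y z] by (simp add: eq_diff_eq)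

lemma nc_mult_diff_right:
  fixes x y z :: "'a::comm_ring_1 ncpoly"
  shows "z \<star> (x - y) = z \<star> x - z \<star> y"
  using nc_mult_add_right[of z "x - y" y] by (simp add: eq_diff_eq)

lemma nc_mult_single:
  fixes c d :: "'a::comm_ring_1"
  shows "Poly_Mapping.single v c \<star> Poly_Mapping.single w d = Poly_Mapping.single (v @ w) (c * d)"
  by (subst nc_mult_eq_sum_supset[where A = "{v}" and B = "{w}"]) auto

lemma nc_mult_single_Nil_left:
  fixes x :: "'a::comm_ring_1 ncpoly"
  shows "Poly_Mapping.single [] c \<star> x = smul c x"
proof (rule poly_mapping_eqI)
  fix u
  have "Poly_Mapping.single [] c \<star> x =
          (\<Sum>w\<in>Poly_Mapping.keys x. Poly_Mapping.single w (c * Poly_Mapping.lookup x w))"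
    by (subst nc_mult_eq_sum_supset[where A = "{[]}" and B = "Poly_Mapping.keys x"]) auto
  then show "Poly_Mapping.lookup (Poly_Mapping.single [] c \<star> x) u = Poly_Mapping.lookup (smul c x) u"
    by (simp add: lookup_sum smul_def lookup_map_zero lookup_single when_def in_keys_iff)
qed

lemma nc_mult_single_Nil_right:
  fixes x :: "'a::comm_ring_1 ncpoly"
  shows "x \<star> Poly_Mapping.single [] 1 = x"
proof (rule poly_mapping_eqI)
  fix u
  have "x \<star> Poly_Mapping.single [] 1 =
          (\<Sum>w\<in>Poly_Mapping.keys x. Poly_Mapping.single w (Poly_Mapping.lookup x w))"
    by (subst nc_mult_eq_sum_supset[where A = "Poly_Mapping.keys x" and B = "{[]}"]) auto
  then show "Poly_Mapping.lookup (x \<star> Poly_Mapping.single [] 1) u = Poly_Mapping.lookup x u"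
    by (simp add: lookup_sum lookup_single when_def in_keys_iff)
qed

lemma lookup_incl: "Poly_Mapping.lookup (incl p) w = of_int (Poly_Mapping.lookup p w)"
  by (simp add: incl_def lookup_map_zero)

lemma keys_incl: "Poly_Mapping.keys (incl p) = Poly_Mapping.keys p"
  by (auto simp: in_keys_iff lookup_incl)

lemma incl_zero: "incl 0 = 0"
  by (rule poly_mapping_eqI) (simp add: lookup_incl)

lemma incl_add: "incl (x + y) = incl x + incl y"
  by (rule poly_mapping_eqI) (simp add: lookup_incl lookup_add)

lemma incl_diff: "incl (x - y) = incl x - incl y"
  by (rule poly_mapping_eqI) (simp add: lookup_incl lookup_minus)

lemma incl_single: "incl (Poly_Mapping.single w c) = Poly_Mapping.single w (of_int c)"
  by (simp add: incl_def)

lemma incl_nc_mult: "incl (p \<star> r) = incl p \<star> incl r"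
proof (rule poly_mapping_eqI)
  fix u
  show "Poly_Mapping.lookup (incl (p \<star> r)) u = Poly_Mapping.lookup (incl p \<star> incl r) u"
    unfolding nc_mult_def keys_incl
    by (simp add: lookup_incl lookup_sum lookup_single when_def of_int_sum if_distrib cong: if_cong)
qed

lemma incl_nc_alg: "a \<in> nc_alg N \<Longrightarrow> incl a \<in> nc_alg N"
  by (simp add: nc_alg_def keys_incl)

lemma single_nc_alg: "set w \<subseteq> {1..N} \<Longrightarrow> Poly_Mapping.single w c \<in> nc_alg N"
  by (simp add: nc_alg_def)

lemma ideal_gen_single_mult:
  "x \<in> ideal_gen N S \<Longrightarrow> set v \<subseteq> {1..N} \<Longrightarrow> set w \<subseteq> {1..N} \<Longrightarrow>
     Poly_Mapping.single v c \<star> x \<star> Poly_Mapping.single w 1 \<in> ideal_gen N S"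
  by (intro ideal_gen.mult single_nc_alg)

lemma ideal_gen_smul: "x \<in> ideal_gen N S \<Longrightarrow> smul c x \<in> ideal_gen N S"
  using ideal_gen_single_mult[of x N S "[]" "[]" c]
  by (simp add: nc_mult_single_Nil_left nc_mult_single_Nil_right)

lemma incl_ideal_gen:
  assumes "\<And>s. s \<in> S \<Longrightarrow> incl s \<in> ideal_gen N T"
    and "x \<in> ideal_gen N S"
  shows "incl x \<in> ideal_gen N T"
  using assms(2)
proof (induction rule: ideal_gen.induct)
  case (gen s)
  then show ?case by (rule assms(1))
next
  case zero
  then show ?case by (simp add: incl_zero ideal_gen.zero)
next
  case (add x y)
  then show ?case by (simp add: incl_add ideal_gen.add)
next
  case (mult a b x)
  then show ?case by (simp add: incl_nc_mult incl_nc_alg ideal_gen.mult)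
qed

lemma scalar_ext_subset_ideal_gen:
  assumes "\<And>x. x \<in> I \<Longrightarrow> incl x \<in> ideal_gen N T"
  shows "scalar_ext I \<subseteq> ideal_gen N T"
proof
  fix y assume "y \<in> scalar_ext I"
  then show "y \<in> ideal_gen N T"
    by induction (simp_all add: assms ideal_gen.zero ideal_gen.add ideal_gen_smul)
qed

lemma qvar_neq_zero: "qvar \<noteq> 0"
  by (simp add: qvar_def Zero_fract_def eq_fract)

definition qcomm :: "nat \<Rightarrow> nat \<Rightarrow> Qq ncpoly" where
  "qcomm a b = mon [a, b] - smul (inverse qvar) (mon [b, a])"

lemma qcomm_eq_single:
  "qcomm a b = Poly_Mapping.single [a, b] 1 - Poly_Mapping.single [b, a] (inverse qvar)"
  by (simp add: qcomm_def mon_def smul_def)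

lemma qcomm_in_lam_ideal:
  "a \<in> {1..N} \<Longrightarrow> b \<in> {1..N} \<Longrightarrow> a < b \<Longrightarrow> b - a < k \<Longrightarrow> qcomm a b \<in> lam_ideal N k"
  unfolding lam_ideal_def qcomm_def lam_gens_def by (rule ideal_gen.gen) blast

lemma comm_in_lam_ideal:
  "a \<in> {1..N} \<Longrightarrow> b \<in> {1..N} \<Longrightarrow> a < b \<Longrightarrow> b - a > k \<Longrightarrow>
     (mon [a, b] - mon [b, a] :: Qq ncpoly) \<in> lam_ideal N k"
  unfolding lam_ideal_def lam_gens_def by (rule ideal_gen.gen) blast

lemma lam_ideal_assaf_far_1:
  assumes "c \<in> {1..N}" "1 \<le> a" "a < b" "b < c" "c - a > k"
  shows "incl (mon [b, a, c] - mon [b, c, a]) \<in> lam_ideal N k"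
proof -
  have "incl (mon [b, a, c] - mon [b, c, a]) =
          Poly_Mapping.single [b] 1 \<star> (mon [a, c] - mon [c, a]) \<star> Poly_Mapping.single [] 1"
    by (simp add: incl_diff mon_def incl_single nc_mult_diff_left nc_mult_diff_right nc_mult_single)
  also have "\<dots> \<in> lam_ideal N k"
    unfolding lam_ideal_def
    by (intro ideal_gen_single_mult comm_in_lam_ideal[unfolded lam_ideal_def]) (use assms in auto)
  finally show ?thesis .
qed

lemma lam_ideal_assaf_far_2:
  assumes "c \<in> {1..N}" "1 \<le> a" "a < b" "b < c" "c - a > k"
  shows "incl (mon [a, c, b] - mon [c, a, b]) \<in> lam_ideal N k"
proof -
  have "incl (mon [a, c, b] - mon [c, a, b]) =
          Poly_Mapping.single [] 1 \<star> (mon [a, c] - mon [c, a]) \<star> Poly_Mapping.single [b] 1"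
    by (simp add: incl_diff mon_def incl_single nc_mult_diff_left nc_mult_diff_right nc_mult_single)
  also have "\<dots> \<in> lam_ideal N k"
    unfolding lam_ideal_def
    by (intro ideal_gen_single_mult comm_in_lam_ideal[unfolded lam_ideal_def]) (use assms in auto)
  finally show ?thesis .
qed

lemma lam_ideal_assaf_near_1:
  assumes "c \<in> {1..N}" "1 \<le> a" "a < b" "b < c" "c - a \<le> k"
  shows "incl (mon [b, a, c] - mon [a, c, b]) \<in> lam_ideal N k"
proof -
  have "incl (mon [b, a, c] - mon [a, c, b]) =
          Poly_Mapping.single [] (- qvar) \<star> qcomm a b \<star> Poly_Mapping.single [c] 1
        + Poly_Mapping.single [a] qvar \<star> qcomm b c \<star> Poly_Mapping.single [] 1"
    using assms qvar_neq_zero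
    by (intro poly_mapping_eqI)
      (simp add: qcomm_eq_single incl_diff mon_def incl_single nc_mult_diff_left nc_mult_diff_right
        nc_mult_single lookup_add lookup_minus lookup_single when_def)
  also have "\<dots> \<in> lam_ideal N k"
    unfolding lam_ideal_def
    by (intro ideal_gen.add ideal_gen_single_mult qcomm_in_lam_ideal[unfolded lam_ideal_def])
      (use assms in auto)
  finally show ?thesis .
qed

lemma lam_ideal_assaf_near_2:
  assumes "c \<in> {1..N}" "1 \<le> a" "a < b" "b < c" "c - a \<le> k"
  shows "incl (mon [b, c, a] - mon [c, a, b]) \<in> lam_ideal N k"
proof -
  have "incl (mon [b, c, a] - mon [c, a, b]) =
          Poly_Mapping.single [] 1 \<star> qcomm b c \<star> Poly_Mapping.single [a] 1
        + Poly_Mapping.single [c] (- 1) \<star> qcomm a b \<star> Poly_Mapping.single [] 1"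
    using assms
    by (intro poly_mapping_eqI)
      (simp add: qcomm_eq_single incl_diff mon_def incl_single nc_mult_diff_left nc_mult_diff_right
        nc_mult_single lookup_add lookup_minus lookup_single when_def)
  also have "\<dots> \<in> lam_ideal N k"
    unfolding lam_ideal_def
    by (intro ideal_gen.add ideal_gen_single_mult qcomm_in_lam_ideal[unfolded lam_ideal_def])
      (use assms in auto)
  finally show ?thesis .
qed

lemma incl_assaf_gens_in_lam_ideal: "s \<in> assaf_gens N k \<Longrightarrow> incl s \<in> lam_ideal N k"
  unfolding assaf_gens_def
  using lam_ideal_assaf_far_1 lam_ideal_assaf_far_2 lam_ideal_assaf_near_1 lam_ideal_assaf_near_2
  by (elim UnE) (auto simp: lam_ideal_def)

theorem proposition4p11:
  fixes N k :: nat
  assumes "k > 0"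
  shows "scalar_ext (assaf_ideal N k) \<subseteq> lam_ideal N k"
  unfolding assaf_ideal_def lam_ideal_def
  by (rule scalar_ext_subset_ideal_gen, rule incl_ideal_gen)
    (simp_all add: incl_assaf_gens_in_lam_ideal[unfolded lam_ideal_def])

end
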